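(* Let $(L,\tau)$ be a locally solid Riesz space with an order bounded $\tau$-neighborhood of zero, let $(M,\tau')$ be a locally solid Riesz space, and let $T:L\to M$ be a positive homogeneous (linear) map that maps $\tau$-bounded subsets of $L$ to order bounded subsets of $M$. Then $T$ is topologically continuous.
   Context: A Riesz space is a real ordered vector space that is a lattice. A subset $Y$ of a Riesz space is solid if $|x|\le|y|$ and $y\in Y$ imply $x\in Y$. A locally solid Riesz space is a Riesz space with a vector topology (not assumed Hausdorff) having a neighborhood base at zero consisting of solid sets. A subset is order bounded if it is contained in some order interval $[u,v]=\{x:u\le x\le v\}$. A subset $A$ of $L$ is $\tau$-bounded if for every $\tau$-neighborhood $V$ of zero there is some $\lambda>0$ with $\lambda A\subset V$. A linear operator $T:L\to M$ is called positive homogeneous if $T(\lambda x)=\lambda T(x)$ for all $x\in L$ and $\lambda>0$ (automatic for linear $T$), and topologically continuous if $T^{-1}(O)\in\tau$ for every $O\in\tau'$. *)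

theory Defs
  imports "HOL-Analysis.Analysis" "HOL-Library.Lattice_Algebras"
begin

text \<open>
  The superclass \<^class>\<open>lattice_ab_group_add_abs\<close> adds nothing to an ordered vector space that is
  a lattice except the absolute value, fixed by \<open>\<bar>x\<bar> = sup x (- x)\<close>.
\<close>

class riesz_space = ordered_real_vector + lattice_ab_group_add_abs

definition solid :: "'a::riesz_space set \<Rightarrow> bool" where
  "solid Y \<longleftrightarrow> (\<forall>x y. \<bar>x\<bar> \<le> \<bar>y\<bar> \<and> y \<in> Y \<longrightarrow> x \<in> Y)"

definition order_bounded :: "'a::riesz_space set \<Rightarrow> bool" where
  "order_bounded A \<longleftrightarrow> (\<exists>u v. A \<subseteq> {u..v})"

text \<open>
  Topologies are explicit, so that a Riesz space may carry any of them; none of the following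
  assumes Hausdorffness.
\<close>

definition vector_topology :: "'a::real_vector topology \<Rightarrow> bool" where
  "vector_topology \<tau> \<longleftrightarrow>
     topspace \<tau> = UNIV \<and>
     continuous_map (prod_topology \<tau> \<tau>) \<tau> (\<lambda>(x, y). x + y) \<and>
     continuous_map (prod_topology euclideanreal \<tau>) \<tau> (\<lambda>(c, x). c *\<^sub>R x)"

definition locally_solid :: "'a::riesz_space topology \<Rightarrow> bool" where
  "locally_solid \<tau> \<longleftrightarrow> vector_topology \<tau> \<and> neighbourhood_base_at 0 solid \<tau>"

text \<open>Neighborhoods of zero need not be open.\<close>

definition zero_neighborhood :: "'a::real_vector topology \<Rightarrow> 'a set \<Rightarrow> bool" where
  "zero_neighborhood \<tau> V \<longleftrightarrow> (\<exists>U. openin \<tau> U \<and> 0 \<in> U \<and> U \<subseteq> V)"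

definition topologically_bounded :: "'a::real_vector topology \<Rightarrow> 'a set \<Rightarrow> bool" where
  "topologically_bounded \<tau> A \<longleftrightarrow>
     (\<forall>V. zero_neighborhood \<tau> V \<longrightarrow> (\<exists>c>0. (\<lambda>x. c *\<^sub>R x) ` A \<subseteq> V))"

definition positive_homogeneous :: "('a::real_vector \<Rightarrow> 'b::real_vector) \<Rightarrow> bool" where
  "positive_homogeneous T \<longleftrightarrow> (\<forall>x. \<forall>c>0. T (c *\<^sub>R x) = c *\<^sub>R T x)"

end

theory Submission
  imports Defs
begin

text \<open>
  Order bounded sets are bounded in a locally solid topology: a small multiple of an upper bound
  of the absolute values lies in a given solid neighborhood of zero. Hence the order bounded
  neighborhood \<open>V\<close> of zero is \<open>\<tau>\<close>-bounded, so \<open>T ` V\<close> is order bounded and therefore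
  \<open>\<tau>'\<close>-bounded. Continuity of \<open>T\<close> at zero follows by homogeneity, and elsewhere by translation.
\<close>

lemma vector_topology_continuous_translation:
  fixes \<tau> :: "'a::real_vector topology"
  assumes "vector_topology \<tau>"
  shows "continuous_map \<tau> \<tau> (\<lambda>x. a + x)"
proof -
  have "continuous_map (prod_topology \<tau> \<tau>) \<tau> (\<lambda>(x, y). x + y)"
    and "continuous_map \<tau> (prod_topology \<tau> \<tau>) (\<lambda>x. (a, x))"
    using assms by (auto simp: vector_topology_def intro: continuous_map_pairedI)
  from continuous_map_compose[OF this(2,1)] show ?thesis
    by (simp add: o_def)
qed

lemma vector_topology_continuous_scaleR_right:
  fixes \<tau> :: "'a::real_vector topology"
  assumes "vector_topology \<tau>"
  shows "continuous_map \<tau> \<tau> (\<lambda>x. c *\<^sub>R x)"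
proof -
  have "continuous_map (prod_topology euclideanreal \<tau>) \<tau> (\<lambda>(c, x). c *\<^sub>R x)"
    and "continuous_map \<tau> (prod_topology euclideanreal \<tau>) (\<lambda>x. (c, x))"
    using assms by (auto simp: vector_topology_def intro: continuous_map_pairedI)
  from continuous_map_compose[OF this(2,1)] show ?thesis
    by (simp add: o_def)
qed

lemma vector_topology_continuous_scaleR_left:
  fixes \<tau> :: "'a::real_vector topology"
  assumes "vector_topology \<tau>"
  shows "continuous_map euclideanreal \<tau> (\<lambda>c. c *\<^sub>R x)"
proof -
  have "continuous_map (prod_topology euclideanreal \<tau>) \<tau> (\<lambda>(c, x). c *\<^sub>R x)"
    and "continuous_map euclideanreal (prod_topology euclideanreal \<tau>) (\<lambda>c. (c, x))"
    using assms by (auto simp: vector_topology_def intro: continuous_map_pairedI)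
  from continuous_map_compose[OF this(2,1)] show ?thesis
    by (simp add: o_def)
qed

text \<open>Stating translation and scaling as a preimage lets openness follow from continuity
  alone, with no inverse map. With \<open>c = 1\<close> it will carry an open set around
  \<open>T x\<close> back to zero; with \<open>inverse c\<close> and \<open>- x\<close> it will
  carry a neighborhood of zero to one of \<open>x\<close>.\<close>

lemma vector_topology_openin_vimage:
  fixes \<tau> :: "'a::real_vector topology"
  assumes "vector_topology \<tau>" "openin \<tau> U"
  shows "openin \<tau> {y. c *\<^sub>R (a + y) \<in> U}"
proof -
  have "continuous_map \<tau> \<tau> (\<lambda>y. c *\<^sub>R (a + y))"
    using continuous_map_compose[OF vector_topology_continuous_translation
        vector_topology_continuous_scaleR_right, OF assms(1) assms(1)]
    by (simp add: o_def)
  then show ?thesis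
    using assms by (auto simp: continuous_map vector_topology_def dest: openin_continuous_map_preimage)
qed

text \<open>For fixed \<open>x\<close> the map sending \<open>c\<close> to
  \<open>c *\<^sub>R x\<close> is continuous and takes 0 to 0, so the scalars sending
  \<open>x\<close> into \<open>U\<close> include a ball around 0, and hence a positive
  number.\<close>

lemma vector_topology_absorbing:
  fixes \<tau> :: "'a::real_vector topology"
  assumes "vector_topology \<tau>" "openin \<tau> U" "0 \<in> U"
  obtains c :: real where "c > 0" "c *\<^sub>R x \<in> U"
proof -
  have "open {c. c *\<^sub>R x \<in> U}"
    using openin_continuous_map_preimage[OF vector_topology_continuous_scaleR_left assms(2)] assms(1)
    by simp
  moreover have "0 \<in> {c. c *\<^sub>R x \<in> U}"
    using assms(3) by simp
  ultimately obtain e where e: "e > 0" "ball 0 e \<subseteq> {c. c *\<^sub>R x \<in> U}"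
    by (meson open_contains_ball)
  then have "e / 2 \<in> ball 0 e"
    by simp
  then have "(e / 2) *\<^sub>R x \<in> U"
    using e(2) by blast
  then show ?thesis
    using e(1) by (intro that[of "e / 2"]) simp_all
qed

lemma order_bounded_imp_topologically_bounded:
  assumes "locally_solid \<tau>" "order_bounded A"
  shows "topologically_bounded \<tau> A"
  unfolding topologically_bounded_def
proof (intro allI impI)
  fix W assume "zero_neighborhood \<tau> W"
  then obtain W' where "openin \<tau> W'" "0 \<in> W'" "W' \<subseteq> W"
    by (auto simp: zero_neighborhood_def)
  moreover have "neighbourhood_base_at 0 solid \<tau>"
    using assms(1) by (simp add: locally_solid_def)
  \<comment> \<open>The solid set \<open>V\<close> need not be open: the open set \<open>U\<close>
    inside it absorbs a vector, and \<open>V\<close> supplies solidity.\<close>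
  ultimately obtain U V where UV: "openin \<tau> U" "solid V" "0 \<in> U" "U \<subseteq> V" "V \<subseteq> W"
    unfolding neighbourhood_base_at_def by (meson order_trans)
  from assms(2) obtain u v where A: "A \<subseteq> {u..v}"
    by (auto simp: order_bounded_def)
  \<comment> \<open>One vector dominating both \<open>x\<close> and \<open>- x\<close> for every
    \<open>x\<close> in the interval: \<open>x \<le> v \<le> \<bar>v\<bar>\<close> and
    \<open>- x \<le> - u \<le> \<bar>u\<bar>\<close>.\<close>
  let ?w = "\<bar>u\<bar> + \<bar>v\<bar>"
  have "vector_topology \<tau>"
    using assms(1) by (simp add: locally_solid_def)
  then obtain c where c: "c > 0" "c *\<^sub>R ?w \<in> U"
    using UV(1,3) by (rule vector_topology_absorbing)
  have "c *\<^sub>R x \<in> V" if "x \<in> A" for x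
  proof -
    have "u \<le> x" "x \<le> v"
      using that A by auto
    then have "x \<le> \<bar>v\<bar>" "- x \<le> \<bar>u\<bar>"
      by (meson abs_ge_self abs_ge_minus_self neg_le_iff_le order_trans)+
    then have "x \<le> ?w" "- x \<le> ?w"
      by (simp_all add: add_increasing add_increasing2)
    then have "c *\<^sub>R x \<le> c *\<^sub>R ?w" "c *\<^sub>R (- x) \<le> c *\<^sub>R ?w"
      using c(1) by (simp_all only: scaleR_left_mono less_imp_le)
    then have "\<bar>c *\<^sub>R x\<bar> \<le> c *\<^sub>R ?w"
      by (simp add: abs_leI)
    \<comment> \<open>Solidity compares absolute values, so the bound has to be one as well.\<close>
    also have "\<dots> \<le> \<bar>c *\<^sub>R ?w\<bar>"
      by (rule abs_ge_self)
    finally show ?thesis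
      using UV c(2) unfolding solid_def by blast
  qed
  then show "\<exists>c>0. (\<lambda>x. c *\<^sub>R x) ` A \<subseteq> W"
    using c(1) UV(5) by blast
qed

text \<open>If \<open>W\<close> is an open set around \<open>T x\<close>, boundedness gives
  \<open>c > 0\<close> with T x + c T(V) inside \<open>W\<close>. By linearity T(x + c U) lies in
  that set for any open \<open>U\<close> inside \<open>V\<close>, and x + c U is a neighborhood of
  \<open>x\<close> when \<open>U\<close> contains 0.\<close>

lemma linear_continuous_map_if_bounded_on_neighborhood:
  fixes \<tau> :: "'a::real_vector topology" and \<tau>' :: "'b::real_vector topology"
  assumes \<tau>: "vector_topology \<tau>" and \<tau>': "vector_topology \<tau>'" and T: "linear T"
    and V: "zero_neighborhood \<tau> V" "topologically_bounded \<tau>' (T ` V)"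
  shows "continuous_map \<tau> \<tau>' T"
proof -
  obtain U where U: "openin \<tau> U" "0 \<in> U" "U \<subseteq> V"
    using V(1) by (auto simp: zero_neighborhood_def)
  have "openin \<tau> {x. T x \<in> W}" if W: "openin \<tau>' W" for W
  proof (subst openin_subopen, intro ballI)
    fix x assume "x \<in> {x. T x \<in> W}"
    then have "zero_neighborhood \<tau>' {y. T x + y \<in> W}"
      using vector_topology_openin_vimage[OF \<tau>' W, of 1 "T x"]
      by (auto simp: zero_neighborhood_def intro!: exI[of _ "{y. T x + y \<in> W}"])
    then obtain c where c: "c > 0" "\<And>v. v \<in> V \<Longrightarrow> T x + c *\<^sub>R T v \<in> W"
      using V(2) unfolding topologically_bounded_def by blast
    \<comment> \<open>This is x + c U, written as a preimage of \<open>U\<close>.\<close>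
    let ?N = "{y. inverse c *\<^sub>R (- x + y) \<in> U}"
    have "T y \<in> W" if "y \<in> ?N" for y
    proof -
      have "T x + c *\<^sub>R T (inverse c *\<^sub>R (- x + y)) \<in> W"
        using that U(3) by (intro c(2)) auto
      also have "T x + c *\<^sub>R T (inverse c *\<^sub>R (- x + y)) = T y"
        using c(1) by (simp add: linear_scale[OF T] linear_diff[OF T])
      finally show ?thesis .
    qed
    moreover have "openin \<tau> ?N" and "x \<in> ?N"
      using vector_topology_openin_vimage[OF \<tau> U(1)] U(2) by (blast, simp)
    ultimately show "\<exists>N. openin \<tau> N \<and> x \<in> N \<and> N \<subseteq> {x. T x \<in> W}"
      by blast
  qed
  then show ?thesis
    using \<tau> \<tau>' by (simp add: continuous_map vector_topology_def)
qed

theorem corollary2p2: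
  fixes \<tau> :: "'l::riesz_space topology"
    and \<tau>' :: "'m::riesz_space topology"
    and T :: "'l \<Rightarrow> 'm"
  assumes "locally_solid \<tau>"
    and "\<exists>V. zero_neighborhood \<tau> V \<and> order_bounded V"
    and "locally_solid \<tau>'"
    and "linear T"
    and "positive_homogeneous T"
    and "\<And>A. topologically_bounded \<tau> A \<Longrightarrow> order_bounded (T ` A)"
  shows "continuous_map \<tau> \<tau>' T"
proof -
  from assms(2) obtain V where V: "zero_neighborhood \<tau> V" "order_bounded V"
    by blast
  then have "topologically_bounded \<tau>' (T ` V)"
    using assms(1,3,6) by (blast intro: order_bounded_imp_topologically_bounded)
  then show ?thesis
    using assms(1,3,4) V(1)
    by (auto simp: locally_solid_def intro: linear_continuous_map_if_bounded_on_neighborhood)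
qed

end
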